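(* Let $A=(a_{ij})$ be a $3\times3$ Cartan matrix of infinite type and $p$ any prime. If the principal submatrix $A_{12}$ is also of infinite type (i.e. $a_{12}a_{21}\ge4$), then $$\mathbb{Q}[\omega_1,\omega_2,\omega_3]=\mathbb{Q}[\omega_1,\omega_2,\omega_3]^{\langle\sigma_1\rangle}+\mathbb{Q}[\omega_1,\omega_2,\omega_3]^{\langle\sigma_2\rangle}=\mathbb{Q}[\omega_1(\omega_1-\alpha_1),\omega_2,\omega_3]+\mathbb{Q}[\omega_1,\omega_2(\omega_2-\alpha_2),\omega_3],$$ whereas $$\mathbb{F}_p[\omega_1,\omega_2,\omega_3]\neq \mathbb{F}_p[\omega_1(\omega_1-\alpha_1),\omega_2,\omega_3]+\mathbb{F}_p[\omega_1,\omega_2(\omega_2-\alpha_2),\omega_3].$$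
   Context: A $3\times 3$ (generalized) Cartan matrix $A=(a_{ij})$ is an integer matrix with $a_{ii}=2$, $a_{ij}\le 0$ for $i\ne j$, $a_{ij}=0\iff a_{ji}=0$; infinite type means indecomposable and not of finite type. Here $\omega_1,\omega_2,\omega_3$ are polynomial generators of degree 2 (so $H^*(BT;R)=R[\omega_1,\omega_2,\omega_3]$ for the maximal torus $T$ of the Kac–Moody group of $A$), $\alpha_j=\sum_{i=1}^3 a_{ij}\omega_i$, and the Weyl reflections act by $\sigma_j(\omega_j)=\omega_j-\alpha_j$, $\sigma_j(\omega_i)=\omega_i$ for $i\ne j$. Sums are sums of subspaces. *)

theory Defs
  imports Complex_Main "HOL-Library.Poly_Mapping" "HOL-Computational_Algebra.Primes" "HOL-Library.Cardinality"
begin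

definition idx3 :: "nat set" where "idx3 = {1,2,3}"

definition cartan3 :: "(nat \<Rightarrow> nat \<Rightarrow> int) \<Rightarrow> bool" where
  "cartan3 A \<longleftrightarrow>
     (\<forall>i\<in>idx3. A i i = 2) \<and>
     (\<forall>i\<in>idx3. \<forall>j\<in>idx3. i \<noteq> j \<longrightarrow> A i j \<le> 0) \<and>
     (\<forall>i\<in>idx3. \<forall>j\<in>idx3. A i j = 0 \<longleftrightarrow> A j i = 0)"

definition indecomposable3 :: "(nat \<Rightarrow> nat \<Rightarrow> int) \<Rightarrow> bool" where
  "indecomposable3 A \<longleftrightarrow>
     \<not> (\<exists>I J. I \<noteq> {} \<and> J \<noteq> {} \<and> I \<inter> J = {} \<and> I \<union> J = idx3 \<and>
             (\<forall>i\<in>I. \<forall>j\<in>J. A i j = 0))"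

text \<open>Finite type (Kac, Thm. 4.3, case (Fin)), for real column vectors indexed by 1,2,3.\<close>
definition matvec3 :: "(nat \<Rightarrow> nat \<Rightarrow> int) \<Rightarrow> (nat \<Rightarrow> real) \<Rightarrow> nat \<Rightarrow> real" where
  "matvec3 A u i = (\<Sum>j\<in>idx3. real_of_int (A i j) * u j)"

definition det3 :: "(nat \<Rightarrow> nat \<Rightarrow> int) \<Rightarrow> int" where
  "det3 A = A 1 1 * (A 2 2 * A 3 3 - A 2 3 * A 3 2)
          - A 1 2 * (A 2 1 * A 3 3 - A 2 3 * A 3 1)
          + A 1 3 * (A 2 1 * A 3 2 - A 2 2 * A 3 1)"

definition finite_type3 :: "(nat \<Rightarrow> nat \<Rightarrow> int) \<Rightarrow> bool" where
  "finite_type3 A \<longleftrightarrow>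
     det3 A \<noteq> 0 \<and>
     (\<exists>u. (\<forall>i\<in>idx3. u i > 0) \<and> (\<forall>i\<in>idx3. matvec3 A u i > 0)) \<and>
     (\<forall>u. (\<forall>i\<in>idx3. matvec3 A u i \<ge> 0) \<longrightarrow>
          (\<forall>i\<in>idx3. u i > 0) \<or> (\<forall>i\<in>idx3. u i = 0))"

definition infinite_type3 :: "(nat \<Rightarrow> nat \<Rightarrow> int) \<Rightarrow> bool" where
  "infinite_type3 A \<longleftrightarrow> indecomposable3 A \<and> \<not> finite_type3 A"

type_synonym 'k mpoly = "(nat \<Rightarrow>\<^sub>0 nat) \<Rightarrow>\<^sub>0 'k"

definition Const :: "'k::comm_ring_1 \<Rightarrow> 'k mpoly" where
  "Const c = Poly_Mapping.single 0 c"

definition Var :: "nat \<Rightarrow> 'k::comm_ring_1 mpoly" where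
  "Var i = Poly_Mapping.single (Poly_Mapping.single i 1) 1"

inductive_set subalg :: "'k::comm_ring_1 mpoly set \<Rightarrow> 'k mpoly set" for G where
  const: "Const c \<in> subalg G"
| gen: "g \<in> G \<Longrightarrow> g \<in> subalg G"
| add: "p \<in> subalg G \<Longrightarrow> q \<in> subalg G \<Longrightarrow> p + q \<in> subalg G"
| mult: "p \<in> subalg G \<Longrightarrow> q \<in> subalg G \<Longrightarrow> p * q \<in> subalg G"

definition polyring :: "'k::comm_ring_1 mpoly set" where
  "polyring = subalg {Var 1, Var 2, Var 3}"

definition mono_eval :: "(nat \<Rightarrow> 'k::comm_ring_1 mpoly) \<Rightarrow> (nat \<Rightarrow>\<^sub>0 nat) \<Rightarrow> 'k mpoly" where
  "mono_eval g m = (\<Prod>i\<in>Poly_Mapping.keys m. g i ^ Poly_Mapping.lookup m i)"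

definition subst :: "(nat \<Rightarrow> 'k::comm_ring_1 mpoly) \<Rightarrow> 'k mpoly \<Rightarrow> 'k mpoly" where
  "subst g P = (\<Sum>m\<in>Poly_Mapping.keys P. Const (Poly_Mapping.lookup P m) * mono_eval g m)"

definition alpha :: "(nat \<Rightarrow> nat \<Rightarrow> int) \<Rightarrow> nat \<Rightarrow> 'k::comm_ring_1 mpoly" where
  "alpha A j = (\<Sum>i\<in>idx3. Const (of_int (A i j)) * Var i)"

definition sigma :: "(nat \<Rightarrow> nat \<Rightarrow> int) \<Rightarrow> nat \<Rightarrow> 'k::comm_ring_1 mpoly \<Rightarrow> 'k mpoly" where
  "sigma A j = subst (\<lambda>i. if i = j then Var j - alpha A j else Var i)"

definition invariants :: "(nat \<Rightarrow> nat \<Rightarrow> int) \<Rightarrow> nat \<Rightarrow> 'k::comm_ring_1 mpoly set" where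
  "invariants A j = {P \<in> polyring. \<forall>n::nat. (sigma A j ^^ n) P = P}"

definition ssum :: "'a::plus set \<Rightarrow> 'a set \<Rightarrow> 'a set" where
  "ssum U V = {u + v | u v. u \<in> U \<and> v \<in> V}"

end

theory Submission
  imports Defs
begin

text \<open>Put \<open>a = - a\<^sub>2\<^sub>1\<close>, \<open>b = - a\<^sub>1\<^sub>2\<close>, \<open>c = - a\<^sub>3\<^sub>1\<close>, \<open>d = - a\<^sub>3\<^sub>2\<close>. If \<open>b\<close> is invertible, the quadratic form
  \<open>q = \<omega>\<^sub>1\<^sup>2 - a \<omega>\<^sub>1 \<omega>\<^sub>2 + (a/b) \<omega>\<^sub>2\<^sup>2 - \<omega>\<^sub>3 (c \<omega>\<^sub>1 + (a d/b) \<omega>\<^sub>2)\<close> lies in both subalgebras, and so does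
  \<open>\<omega>\<^sub>3\<close>, so their sum \<open>J\<close> is closed under multiplication by \<open>q\<close> and \<open>\<omega>\<^sub>3\<close>. Modulo \<open>q\<close> and \<open>\<omega>\<^sub>3\<close> the
  monomials \<open>\<omega>\<^sub>1\<^sup>k \<omega>\<^sub>2\<^sup>n\<^sup>-\<^sup>k\<close> obey a linear recurrence in \<open>k\<close>; since \<open>\<omega>\<^sub>2\<^sup>n \<in> J\<close>, by induction on \<open>n\<close> they are
  congruent modulo \<open>J\<close> to \<open>U\<^sub>k \<omega>\<^sub>1 \<omega>\<^sub>2\<^sup>n\<^sup>-\<^sup>1\<close> with \<open>U\<close> the Lucas sequence of parameters \<open>a\<close>, \<open>a/b\<close>. As
  \<open>\<omega>\<^sub>1\<^sup>n \<in> J\<close> too, everything lies in \<open>J\<close> as soon as no \<open>U\<^sub>n\<close> with \<open>n > 0\<close> vanishes. Over the rationals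
  this holds because \<open>a b \<ge> 4\<close> makes the discriminant \<open>a\<^sup>2 - 4 a/b\<close> nonnegative. Over a finite field \<open>U\<close>
  is periodic, so \<open>U\<^sub>N = 0\<close> for some \<open>N > 0\<close>, and the functional sending
  \<open>\<omega>\<^sub>1\<^sup>k \<omega>\<^sub>2\<^sup>N\<^sup>-\<^sup>k\<close> to \<open>U\<^sub>k\<close> annihilates \<open>J\<close> but not \<open>\<omega>\<^sub>1 \<omega>\<^sub>2\<^sup>N\<^sup>-\<^sup>1\<close>. When \<open>a\<close> or \<open>b\<close> vanishes in the
  field, a single coefficient in degree twice the characteristic does the same.\<close>

section \<open>Linear functionals, substitution and subalgebras of polynomials\<close>

lemma mpoly_induct [case_names single add]:
  fixes f :: "'k::comm_ring_1 mpoly"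
  assumes single: "\<And>m c. P (Poly_Mapping.single m c)"
    and add: "\<And>f g. P f \<Longrightarrow> P g \<Longrightarrow> P (f + g)"
  shows "P f"
proof (induction f rule: update_induct)
  case const
  show ?case using single[of 0 0] by simp
next
  case (update f a b)
  have "Poly_Mapping.update a b f = f + Poly_Mapping.single a b"
    using update(1) by (intro poly_mapping_eqI)
      (auto simp: lookup_update lookup_add lookup_single when_def in_keys_iff)
  then show ?case using add[OF update(3) single] by simp
qed

lemma Const_0 [simp]: "Const 0 = 0" and Const_1 [simp]: "Const 1 = 1"
  and Const_numeral [simp]: "Const (numeral k) = numeral k"
  and Const_add: "Const (c + d) = Const c + Const d"
  and Const_diff: "Const (c - d) = Const c - Const d"
  and Const_mult: "Const (c * d) = Const c * Const d"
  and Const_uminus: "Const (- c) = - Const c"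
  by (simp_all add: Const_def single_add mult_single single_uminus single_diff)

definition weighted_sum :: "((nat \<Rightarrow>\<^sub>0 nat) \<Rightarrow> 'k) \<Rightarrow> 'k::comm_ring_1 mpoly \<Rightarrow> 'k" where
  "weighted_sum w f = (\<Sum>m\<in>Poly_Mapping.keys f. Poly_Mapping.lookup f m * w m)"

lemma weighted_sum_single [simp]: "weighted_sum w (Poly_Mapping.single m c) = c * w m"
  by (simp add: weighted_sum_def)

lemma weighted_sum_add: "weighted_sum w (f + g) = weighted_sum w f + weighted_sum w g"
  unfolding weighted_sum_def
  by (rule setsum_keys_plus_distrib) (simp_all add: algebra_simps)

lemma weighted_sum_Const_mult: "weighted_sum w (Const c * f) = c * weighted_sum w f"
  by (induction f rule: mpoly_induct)
    (simp_all add: Const_def mult_single weighted_sum_add distrib_left mult.assoc)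

lemma weighted_sum_uminus: "weighted_sum w (- f) = - weighted_sum w f"
  using weighted_sum_Const_mult[of w "- 1" f] by (simp add: Const_uminus)

lemma weighted_sum_diff: "weighted_sum w (f - g) = weighted_sum w f - weighted_sum w g"
  using weighted_sum_add[of w f "- g"] by (simp add: weighted_sum_uminus)

lemma weighted_sum_Var_mult:
  "weighted_sum w (Var i * f) = weighted_sum (\<lambda>m. w (Poly_Mapping.single i 1 + m)) f"
  by (induction f rule: mpoly_induct)
    (simp_all add: Var_def mult_single weighted_sum_add distrib_left)

text \<open>By linearity a relation needs checking on monomials only; this turns a recurrence
  between weights into a relation between functionals.\<close>

lemma weighted_sum_linear_eq_0:
  assumes "\<And>m. c1 * w1 m + c2 * w2 m + c3 * w3 m = 0"
  shows "c1 * weighted_sum w1 f + c2 * weighted_sum w2 f + c3 * weighted_sum w3 f = 0"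
proof (induction f rule: mpoly_induct)
  case (single m c)
  show ?case using arg_cong[OF assms[of m], of "\<lambda>t. c * t"] by (simp add: algebra_simps)
next
  case (add f g)
  then show ?case by (simp add: weighted_sum_add algebra_simps)
      (metis (no_types, lifting) add.assoc add.left_commute add.right_neutral)
qed

lemma Var_power: "Var i ^ n = Poly_Mapping.single (Poly_Mapping.single i n) (1::'k::comm_ring_1)"
proof (induction n)
  case (Suc n)
  then show ?case by (simp add: Var_def mult_single flip: single_add)
qed simp

lemma subst_add: "subst g (f + h) = subst g f + subst g h"
  unfolding subst_def
  by (rule setsum_keys_plus_distrib) (simp_all add: algebra_simps Const_add)

lemma mono_eval_superset:
  assumes "finite S" "Poly_Mapping.keys m \<subseteq> S"
  shows "mono_eval g m = (\<Prod>i\<in>S. g i ^ Poly_Mapping.lookup m i)"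
  unfolding mono_eval_def
  using assms by (intro prod.mono_neutral_left) (auto simp: in_keys_iff)

lemma mono_eval_add: "mono_eval g (m + n) = mono_eval g m * mono_eval g n"
proof -
  let ?S = "Poly_Mapping.keys m \<union> Poly_Mapping.keys n"
  have "finite ?S" "Poly_Mapping.keys (m + n) \<subseteq> ?S"
    by (simp_all add: keys_add)
  then show ?thesis
    by (simp add: mono_eval_superset[of ?S] lookup_add power_add prod.distrib)
qed

lemma subst_single: "subst g (Poly_Mapping.single m c) = Const c * mono_eval g m"
  by (simp add: subst_def)

lemma subst_single_mult:
  "subst g (Poly_Mapping.single m c * h) = Const c * mono_eval g m * subst g h"
proof (induction h rule: mpoly_induct)
  case (single n d)
  then show ?case
    by (simp add: mult_single subst_single mono_eval_add Const_mult mult_ac)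
qed (simp add: subst_add distrib_left)

lemma subst_mult: "subst g (f * h) = subst g f * subst g h"
  by (induction f rule: mpoly_induct)
    (simp_all add: subst_single_mult subst_single subst_add distrib_right)

lemma subst_Const [simp]: "subst g (Const c) = Const c"
  unfolding Const_def subst_single by (simp add: mono_eval_def Const_def)

lemma subst_Var [simp]: "subst g (Var i) = g i"
  unfolding Var_def subst_single by (simp add: mono_eval_def)

lemma subst_uminus: "subst g (- f) = - subst g f"
proof -
  have "subst g (- f) = subst g (Const (- 1) * f)"
    by (simp add: Const_uminus)
  also have "\<dots> = Const (- 1) * subst g f"
    by (simp only: subst_mult subst_Const)
  finally show ?thesis
    by (simp add: Const_uminus)
qed

lemma subst_diff: "subst g (f - h) = subst g f - subst g h"
  using subst_add[of g f "- h"] by (simp add: subst_uminus)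

lemma subst_fixes_subalg:
  assumes "f \<in> subalg G" "\<And>h. h \<in> G \<Longrightarrow> subst g h = h"
  shows "subst g f = f"
  using assms(1) by induction (simp_all add: assms(2) subst_add subst_mult)

lemma subalg_least:
  assumes "f \<in> subalg G" "\<And>c. Const c \<in> B" "G \<subseteq> B"
    "\<And>f g. f \<in> B \<Longrightarrow> g \<in> B \<Longrightarrow> f + g \<in> B" "\<And>f g. f \<in> B \<Longrightarrow> g \<in> B \<Longrightarrow> f * g \<in> B"
  shows "f \<in> B"
  using assms(1) by induction (use assms in auto)

lemma subalg_mono: assumes "G \<subseteq> subalg H" shows "subalg G \<subseteq> subalg H"
  using subalg_least[of _ G "subalg H"] assms by (auto intro: subalg.intros)

lemma subalg_uminus: assumes "f \<in> subalg G" shows "- f \<in> subalg G"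
  using subalg.mult[OF subalg.const[of "- 1"] assms] by (simp add: Const_uminus)

lemma subalg_diff: "f \<in> subalg G \<Longrightarrow> g \<in> subalg G \<Longrightarrow> f - g \<in> subalg G"
  using subalg.add[of f G "- g"] subalg_uminus by auto

lemma subalg_power: "f \<in> subalg G \<Longrightarrow> f ^ n \<in> subalg G"
  by (induction n) (use subalg.const[of 1 G] in \<open>auto intro: subalg.mult\<close>)

text \<open>The induction is over the predicate that multiplication by \<open>f\<close> preserves
  \<open>{h. \<forall>m\<in>M. m * h \<in> V}\<close>, since membership in \<open>V\<close> itself is not multiplicative.\<close>
lemma subalg_subset_subspace:
  assumes "f \<in> subalg G" and "1 \<in> M"
    and M: "\<And>g m. g \<in> G \<Longrightarrow> m \<in> M \<Longrightarrow> m * g \<in> M"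
    and "M \<subseteq> V" and add: "\<And>u v. u \<in> V \<Longrightarrow> v \<in> V \<Longrightarrow> u + v \<in> V"
    and scale: "\<And>c v. v \<in> V \<Longrightarrow> Const c * v \<in> V"
  shows "f \<in> V"
proof -
  have "\<forall>m\<in>M. m * (f * h) \<in> V" if "\<forall>m\<in>M. m * h \<in> V" for h
    using assms(1) that
  proof (induction arbitrary: h)
    case (const c)
    then show ?case using scale by (metis mult.left_commute)
  next
    case (gen g)
    then show ?case using M by (metis mult.assoc)
  next
    case (add p q)
    then show ?case by (simp add: assms(5) distrib_right distrib_left)
  next
    case (mult p q)
    then show ?case by (simp add: mult.assoc)
  qed
  from this[of 1] have "\<forall>m\<in>M. m * f \<in> V" using assms(4) by auto
  with \<open>1 \<in> M\<close> show ?thesis by force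
qed


section \<open>Lucas sequences and the monomials they control\<close>

fun lucas :: "'k::comm_ring_1 \<Rightarrow> 'k \<Rightarrow> nat \<Rightarrow> 'k" where
  "lucas P Q 0 = 0"
| "lucas P Q (Suc 0) = 1"
| "lucas P Q (Suc (Suc n)) = P * lucas P Q (Suc n) - Q * lucas P Q n"

text \<open>With nonnegative discriminant, the bound \<open>P / 2\<close> on the ratio of
  consecutive terms propagates, because \<open>Q \<le> (P / 2)\<^sup>2\<close>.\<close>

lemma lucas_pos:
  fixes P Q :: "'k::linordered_field"
  assumes "P > 0" "P\<^sup>2 \<ge> 4 * Q"
  shows "lucas P Q (Suc n) > 0"
proof -
  have "lucas P Q n \<ge> 0 \<and> lucas P Q (Suc n) \<ge> P / 2 * lucas P Q n \<and> lucas P Q (Suc n) > 0"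
  proof (induction n)
    case (Suc n)
    have "Q * lucas P Q n \<le> P\<^sup>2 / 4 * lucas P Q n"
      using Suc assms by (intro mult_right_mono) auto
    also have "\<dots> = P / 2 * (P / 2 * lucas P Q n)"
      by (simp add: power2_eq_square)
    also have "\<dots> \<le> P / 2 * lucas P Q (Suc n)"
      using Suc assms by (intro mult_left_mono) auto
    finally have "lucas P Q (Suc (Suc n)) \<ge> P / 2 * lucas P Q (Suc n)"
      by simp
    moreover have "P / 2 * lucas P Q (Suc n) > 0"
      using Suc assms by (intro mult_pos_pos) auto
    ultimately show ?case using Suc by linarith
  qed simp
  then show ?thesis by simp
qed

text \<open>Since \<open>Q \<noteq> 0\<close>, the shift on pairs of consecutive terms is injective;
  on a finite set the orbit of \<open>(0, 1)\<close> must return to its start.\<close>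

lemma lucas_periodic:
  fixes P Q :: "'k::{field,finite}"
  assumes "Q \<noteq> 0"
  obtains n where "n > 0" "lucas P Q n = 0"
proof -
  define step where "step = (\<lambda>(s, t). (t, P * t - Q * s))"
  have funpow: "(step ^^ n) (0, 1) = (lucas P Q n, lucas P Q (Suc n))" for n
    by (induction n) (simp_all add: step_def)
  have "inj step"
    using assms by (auto simp: step_def inj_def)
  moreover have "finite {y. \<exists>n. y = (step ^^ n) (0, 1)}"
    by (rule finite_subset[OF subset_UNIV]) simp
  ultimately obtain n where "n > 0" "(step ^^ n) (0, 1) = (0, 1)"
    by (rule funpow_inj_finite)
  then show ?thesis
    using that funpow[of n] by simp
qed

lemma subspace_contains_monomials:
  fixes J :: "'k::field mpoly set"
  assumes add: "\<And>f g. f \<in> J \<Longrightarrow> g \<in> J \<Longrightarrow> f + g \<in> J"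
    and scale: "\<And>c f. f \<in> J \<Longrightarrow> Const c * f \<in> J"
    and Z: "\<And>f. f \<in> J \<Longrightarrow> Z * f \<in> J"
    and q: "\<And>f. f \<in> J \<Longrightarrow>
      (X\<^sup>2 - Const P * X * Y + Const Q * Y\<^sup>2 - Z * (Const c * X + Const d * Y)) * f \<in> J"
    and X: "\<And>n. X ^ n \<in> J" and Y: "\<And>n. Y ^ n \<in> J"
    and nz: "\<And>n. lucas P Q (Suc n) \<noteq> 0"
  shows "X ^ k * Y ^ l \<in> J"
proof (induction "k + l" arbitrary: k l rule: less_induct)
  case less
  show ?case
  proof (cases "k + l")
    case 0
    then show ?thesis using X[of 0] by simp
  next
    case (Suc n)
    define e where "e = X * Y ^ n"
    have reduce: "X ^ r * Y ^ s - Const (lucas P Q r) * e \<in> J" if "r + s = Suc n" for r s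
      using that
    proof (induction r arbitrary: s rule: induct_nat_012)
      case 0
      then show ?case using Y[of "Suc n"] by simp
    next
      case 1
      then show ?case using scale[OF X[of 0], of 0] by (simp add: e_def)
    next
      case (ge2 r)
      define m where "m = X ^ r * Y ^ s"
      \<comment> \<open>These products have smaller total degree in \<open>X\<close> and
        \<open>Y\<close>, so the outer induction covers the \<open>Z\<close> part of the relation
        and the multiple of the quadratic form.\<close>
      have J: "X * m \<in> J" "Y * m \<in> J" "m \<in> J"
        using less[of "Suc r" s] less[of r "Suc s"] less[of r s] ge2.prems Suc
        by (simp_all add: m_def mult_ac)
      have "X ^ Suc (Suc r) * Y ^ s - Const (lucas P Q (Suc (Suc r))) * e =
        (X\<^sup>2 - Const P * X * Y + Const Q * Y\<^sup>2 - Z * (Const c * X + Const d * Y)) * m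
        + (Z * (Const c * (X * m) + Const d * (Y * m))
        + (Const P * (X ^ Suc r * Y ^ Suc s - Const (lucas P Q (Suc r)) * e)
        + Const (- Q) * (X ^ r * Y ^ Suc (Suc s) - Const (lucas P Q r) * e)))"
        by (simp add: m_def Const_mult Const_add Const_uminus Const_diff power2_eq_square algebra_simps)
      also have "\<dots> \<in> J"
        using ge2.prems by (intro add q Z scale J ge2.IH) auto
      finally show ?case .
    qed
    have diff: "f - g \<in> J" if "f \<in> J" "g \<in> J" for f g
      using add[OF that(1) scale[OF that(2), of "- 1"]] by (simp add: Const_uminus)
    \<comment> \<open>\<open>X ^ Suc n\<close> lies in \<open>J\<close> and also reduces to a
      multiple of \<open>e\<close>; the nonzero coefficient then puts \<open>e\<close> itself into
      \<open>J\<close>.\<close>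
    have "Const (lucas P Q (Suc n)) * e \<in> J"
      using diff[OF X[of "Suc n"] reduce[of "Suc n" 0]] by simp
    from scale[OF this, of "inverse (lucas P Q (Suc n))"] have "e \<in> J"
      using nz[of n] by (simp flip: mult.assoc Const_mult)
    from add[OF reduce[OF Suc] scale[OF this, of "lucas P Q k"]] show ?thesis
      by simp
  qed
qed

section \<open>Orbit products and the invariants of a reflection\<close>

text \<open>With \<open>a = - a\<^sub>j\<^sub>i\<close> and \<open>c = - a\<^sub>3\<^sub>i\<close> this is \<open>\<omega>\<^sub>i \<sigma>\<^sub>i(\<omega>\<^sub>i) = \<omega>\<^sub>i (\<omega>\<^sub>i - \<alpha>\<^sub>i)\<close>.\<close>
definition orbit_product :: "nat \<Rightarrow> nat \<Rightarrow> 'k \<Rightarrow> 'k \<Rightarrow> 'k::comm_ring_1 mpoly" where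
  "orbit_product i j a c = Var i * (Const a * Var j + Const c * Var 3 - Var i)"

definition reflection_subalg :: "nat \<Rightarrow> nat \<Rightarrow> 'k \<Rightarrow> 'k \<Rightarrow> 'k::comm_ring_1 mpoly set" where
  "reflection_subalg i j a c = subalg {orbit_product i j a c, Var j, Var 3}"

lemma alpha_eq:
  fixes A :: "nat \<Rightarrow> nat \<Rightarrow> int"
  assumes "cartan3 A" "idx3 = {i, j, 3}" "distinct [i, j, 3]"
  shows "(alpha A i :: 'k::comm_ring_1 mpoly) =
    2 * Var i + (Const (of_int (A j i)) * Var j + Const (of_int (A 3 i)) * Var 3)"
proof -
  have "i \<in> idx3" using assms(2) by blast
  then have "A i i = 2" using assms(1) by (simp add: cartan3_def)
  then show ?thesis
    unfolding alpha_def assms(2) using assms(3) by simp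
qed

lemma orbit_product_eq:
  fixes A :: "nat \<Rightarrow> nat \<Rightarrow> int"
  assumes "cartan3 A" "idx3 = {i, j, 3}" "distinct [i, j, 3]"
  shows "Var i * (Var i - alpha A i) =
    (orbit_product i j (of_int (- A j i)) (of_int (- A 3 i)) :: 'k::comm_ring_1 mpoly)"
  by (simp add: alpha_eq[OF assms] orbit_product_def Const_uminus algebra_simps)

lemma polyring_eq:
  assumes "idx3 = {i, j, 3}"
  shows "polyring = subalg {Var i, Var j, Var 3 :: 'k::comm_ring_1 mpoly}"
proof -
  have "{Var 1, Var 2, Var 3} = {Var i, Var j, Var 3 :: 'k mpoly}"
    using arg_cong[OF assms, of "image (Var :: nat \<Rightarrow> 'k mpoly)"] by (simp add: idx3_def)
  then show ?thesis
    unfolding polyring_def by (rule arg_cong)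
qed

lemma reflection_subalg_subset_polyring:
  assumes "idx3 = {i, j, 3}"
  shows "reflection_subalg i j a c \<subseteq> polyring"
  unfolding reflection_subalg_def orbit_product_def polyring_eq[OF assms]
  by (intro subalg_mono)
    (auto intro!: subalg.mult subalg.add subalg_diff subalg.const intro: subalg.gen)

text \<open>The reflection exchanges the two factors \<open>Var i\<close> and
  \<open>\<beta> - Var i\<close> of the orbit product, as \<beta> involves only the fixed
  variables.\<close>

lemma reflection_subalg_subset_invariants:
  fixes A :: "nat \<Rightarrow> nat \<Rightarrow> int"
  assumes "cartan3 A" "idx3 = {i, j, 3}" "distinct [i, j, 3]"
  shows "reflection_subalg i j (of_int (- A j i)) (of_int (- A 3 i)) \<subseteq>
    (invariants A i :: 'k::comm_ring_1 mpoly set)"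
proof
  fix f :: "'k mpoly"
  assume f: "f \<in> reflection_subalg i j (of_int (- A j i)) (of_int (- A 3 i))"
  define \<beta> where "\<beta> = Const (of_int (- A j i)) * Var j + Const (of_int (- A 3 i)) * (Var 3 :: 'k mpoly)"
  have Var_minus_alpha: "Var i - alpha A i = \<beta> - (Var i :: 'k mpoly)"
    by (simp add: alpha_eq[OF assms] \<beta>_def Const_uminus)
  have \<beta>: "sigma A i \<beta> = \<beta>"
    using assms(3) by (simp add: sigma_def \<beta>_def subst_add subst_mult)
  have "sigma A i f = f"
    unfolding sigma_def
  proof (rule subst_fixes_subalg[OF f[unfolded reflection_subalg_def]])
    fix h :: "'k mpoly"
    assume "h \<in> {orbit_product i j (of_int (- A j i)) (of_int (- A 3 i)), Var j, Var 3}"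
    moreover have "sigma A i (Var i * (\<beta> - Var i)) = Var i * (\<beta> - Var i)"
      using \<beta> by (simp add: sigma_def subst_mult subst_diff Var_minus_alpha)
    ultimately show "subst (\<lambda>k. if k = i then Var i - alpha A i else Var k) h = h"
      using assms(3) by (auto simp: orbit_product_def \<beta>_def sigma_def)
  qed
  then have "(sigma A i ^^ n) f = f" for n
    by (induction n) simp_all
  moreover have "f \<in> polyring"
    using f reflection_subalg_subset_polyring[OF assms(2)] by blast
  ultimately show "f \<in> invariants A i"
    by (simp add: invariants_def)
qed

section \<open>Sums of two subalgebras and the equality over an ordered field\<close>

lemma ssumI: "u \<in> U \<Longrightarrow> v \<in> V \<Longrightarrow> u + v \<in> ssum U V"
  unfolding ssum_def by blast

lemma ssum_mono: "U \<subseteq> U' \<Longrightarrow> V \<subseteq> V' \<Longrightarrow> ssum U V \<subseteq> ssum U' V'"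
  unfolding ssum_def by blast

lemma ssum_commute: "ssum U V = ssum V (U :: 'a::ab_semigroup_add set)"
  unfolding ssum_def by (auto; metis add.commute)

lemma zero_in_subalg: "0 \<in> subalg G"
  using subalg.const[of 0 G] by simp

lemma ssum_subalg_add:
  assumes "f \<in> ssum (subalg G) (subalg H)" "g \<in> ssum (subalg G) (subalg H)"
  shows "f + g \<in> ssum (subalg G) (subalg H)"
proof -
  from assms obtain u v u' v' where "f = u + v" "g = u' + v'" "u \<in> subalg G" "v \<in> subalg H"
    "u' \<in> subalg G" "v' \<in> subalg H"
    unfolding ssum_def by blast
  then show ?thesis
    using ssumI[OF subalg.add[of u G u'] subalg.add[of v H v']] by (simp add: add_ac)
qed

lemma ssum_subalg_mult:
  assumes "r \<in> subalg G" "r \<in> subalg H" "f \<in> ssum (subalg G) (subalg H)"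
  shows "r * f \<in> ssum (subalg G) (subalg H)"
proof -
  from assms obtain u v where "f = u + v" "u \<in> subalg G" "v \<in> subalg H"
    unfolding ssum_def by blast
  then show ?thesis
    using assms ssumI[OF subalg.mult[of r G u] subalg.mult[of r H v]] by (simp add: distrib_left)
qed

lemma ssum_subalg_left: "f \<in> subalg G \<Longrightarrow> f \<in> ssum (subalg G) (subalg H)"
  using ssumI[OF _ zero_in_subalg] by force

lemma ssum_subalg_right: "f \<in> subalg H \<Longrightarrow> f \<in> ssum (subalg G) (subalg H)"
  using ssumI[OF zero_in_subalg] by force

lemma ssum_reflection_subalgs_eq_polyring:
  fixes a b c d :: "'k::linordered_field"
  assumes "idx3 = {i, j, 3}" "a > 0" "b > 0" "a * b \<ge> 4"
  shows "ssum (reflection_subalg i j a c) (reflection_subalg j i b d) = polyring"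
    (is "?J = _")
proof
  show "?J \<subseteq> polyring"
  proof -
    have "idx3 = {j, i, 3}" using assms(1) by auto
    then show ?thesis
      using reflection_subalg_subset_polyring[OF assms(1), of a c]
        reflection_subalg_subset_polyring[of j i b d]
      by (auto simp: ssum_def polyring_def intro!: subalg.add)
  qed
next
  note defs = reflection_subalg_def
  \<comment> \<open>This ratio gives \<open>Q\<close> times the second orbit product the same
    \<open>Var i * Var j\<close> term as the first, so one form \<open>?q\<close> lies in both
    subalgebras.\<close>
  define Q where "Q = a / b"
  have Qb: "Q * b = a" using assms by (simp add: Q_def)
  let ?X = "Var i :: 'k mpoly" and ?Y = "Var j :: 'k mpoly" and ?Z = "Var 3 :: 'k mpoly"
  let ?q = "?X\<^sup>2 - Const a * ?X * ?Y + Const Q * ?Y\<^sup>2 - ?Z * (Const c * ?X + Const (Q * d) * ?Y)"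
  have "?q = Const Q * ?Y\<^sup>2 - Const (Q * d) * ?Y * ?Z - orbit_product i j a c"
    by (simp add: orbit_product_def algebra_simps power2_eq_square)
  also have "\<dots> \<in> reflection_subalg i j a c"
    unfolding defs by (intro subalg_diff subalg.mult subalg_power subalg.const) (auto intro: subalg.gen)
  finally have q1: "?q \<in> reflection_subalg i j a c" .
  have "?q = ?X\<^sup>2 - Const c * ?X * ?Z - Const Q * orbit_product j i b d"
    by (simp add: orbit_product_def Const_mult algebra_simps power2_eq_square flip: Qb)
  also have "\<dots> \<in> reflection_subalg j i b d"
    unfolding defs by (intro subalg_diff subalg.mult subalg_power subalg.const) (auto intro: subalg.gen)
  finally have q2: "?q \<in> reflection_subalg j i b d" .
  have add: "f + g \<in> ?J" if "f \<in> ?J" "g \<in> ?J" for f g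
    using that unfolding defs by (rule ssum_subalg_add)
  have scale: "Const e * f \<in> ?J" if "f \<in> ?J" for e f
    using that unfolding defs by (intro ssum_subalg_mult subalg.const)
  have Z: "?Z * f \<in> ?J" if "f \<in> ?J" for f
    using that unfolding defs by (intro ssum_subalg_mult subalg.gen) auto
  have q: "?q * f \<in> ?J" if "f \<in> ?J" for f
    using that q1 q2 unfolding defs by (intro ssum_subalg_mult)
  have X: "?X ^ n \<in> ?J" and Y: "?Y ^ n \<in> ?J" for n
    unfolding defs
    by (intro ssum_subalg_right subalg_power subalg.gen, simp,
        intro ssum_subalg_left subalg_power subalg.gen, simp)
  have "a\<^sup>2 \<ge> 4 * Q"
    using assms mult_left_mono[OF assms(4), of a] by (simp add: Q_def field_simps power2_eq_square)
  then have "lucas a Q (Suc n) \<noteq> 0" for n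
    using lucas_pos[OF assms(2), of Q n] by simp
  note mono = subspace_contains_monomials[OF add scale Z q X Y this]
  have monoZ: "?X ^ k * ?Y ^ l * ?Z ^ m \<in> ?J" for k l m
  proof (induction m)
    case (Suc m)
    from Z[OF this] show ?case by (simp add: mult_ac)
  qed (use mono in simp)
  show "polyring \<subseteq> ?J"
  proof
    fix f :: "'k mpoly"
    assume "f \<in> polyring"
    then have "f \<in> subalg {?X, ?Y, ?Z}"
      unfolding polyring_eq[OF assms(1)] .
    then show "f \<in> ?J"
    proof (rule subalg_subset_subspace[where M = "{?X ^ k * ?Y ^ l * ?Z ^ m | k l m. True}"])
      show "1 \<in> {?X ^ k * ?Y ^ l * ?Z ^ m | k l m. True}"
        using power_0 mult_1 by (metis (mono_tags, lifting) mem_Collect_eq)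
    next
      fix g m
      assume "g \<in> {?X, ?Y, ?Z}" "m \<in> {?X ^ k * ?Y ^ l * ?Z ^ m | k l m. True}"
      then obtain k l n where "g = ?X \<or> g = ?Y \<or> g = ?Z" "m = ?X ^ k * ?Y ^ l * ?Z ^ n"
        by auto
      then have "m * g = ?X ^ Suc k * ?Y ^ l * ?Z ^ n \<or> m * g = ?X ^ k * ?Y ^ Suc l * ?Z ^ n \<or>
          m * g = ?X ^ k * ?Y ^ l * ?Z ^ Suc n"
        by (auto simp: mult_ac)
      then show "m * g \<in> {?X ^ k * ?Y ^ l * ?Z ^ m | k l m. True}"
        by blast
    qed (use monoZ add scale in auto)
  qed
qed


section \<open>Functionals annihilating the sum over a finite field\<close>

lemma weighted_sum_zero: "(\<And>m. w m = 0) \<Longrightarrow> weighted_sum w f = 0"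
  by (simp add: weighted_sum_def)

lemma weighted_sum_monomial:
  "weighted_sum w (Var i ^ k * Var j ^ l) = w (Poly_Mapping.single i k + Poly_Mapping.single j l)"
  by (simp add: Var_power mult_single)

text \<open>Ignoring terms with \<open>Var 3\<close> makes the parameters \<open>c\<close> and
  \<open>d\<close> of the orbit products invisible to the functional.\<close>

definition slice_weight :: "nat \<Rightarrow> nat \<Rightarrow> nat \<Rightarrow> (nat \<Rightarrow> 'k) \<Rightarrow> (nat \<Rightarrow>\<^sub>0 nat) \<Rightarrow> 'k::comm_ring_1" where
  "slice_weight i j N s m =
     (if Poly_Mapping.lookup m 3 = 0 \<and> Poly_Mapping.lookup m i + Poly_Mapping.lookup m j = N
      then s (Poly_Mapping.lookup m i) else 0)"

abbreviation slice_sum :: "nat \<Rightarrow> nat \<Rightarrow> nat \<Rightarrow> (nat \<Rightarrow> 'k) \<Rightarrow> 'k::comm_ring_1 mpoly \<Rightarrow> 'k" where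
  "slice_sum i j N s \<equiv> weighted_sum (slice_weight i j N s)"

lemma slice_sum_Var3_mult [simp]: "slice_sum i j N s (Var 3 * f) = 0"
  unfolding weighted_sum_Var_mult
  by (rule weighted_sum_zero) (simp add: slice_weight_def lookup_add)

lemma slice_sum_monomial:
  assumes "distinct [i, j, 3]"
  shows "slice_sum i j N s (Var i ^ k * Var j ^ l) = (if k + l = N then s k else 0)"
  unfolding weighted_sum_monomial using assms
  by (simp add: slice_weight_def lookup_add lookup_single)

text \<open>Multiplying by a variable shifts the weights, so a recurrence for \<open>s\<close> says
  that multiples of the corresponding quadratic form are killed.\<close>

lemma slice_sum_recurrence:
  assumes "distinct [i, j, 3]"
    and "\<And>k. c1 * s (Suc (Suc k)) + c2 * s (Suc k) + c3 * s k = 0"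
  shows "c1 * slice_sum i j N s (Var i * (Var i * f)) + c2 * slice_sum i j N s (Var i * (Var j * f))
    + c3 * slice_sum i j N s (Var j * (Var j * f)) = 0"
  unfolding weighted_sum_Var_mult using assms(1)
  by (intro weighted_sum_linear_eq_0) (auto simp: slice_weight_def lookup_add lookup_single assms(2))

lemma slice_sum_orbit_product_mult:
  "slice_sum i j N s (orbit_product k l a c * f) =
    a * slice_sum i j N s (Var k * (Var l * f)) - slice_sum i j N s (Var k * (Var k * f))"
proof -
  have "orbit_product k l a c * f =
      Const a * (Var k * (Var l * f)) + Const c * (Var 3 * (Var k * f)) - Var k * (Var k * f)"
    by (simp add: orbit_product_def algebra_simps)
  then show ?thesis
    by (simp add: weighted_sum_add weighted_sum_diff weighted_sum_Const_mult)
qed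

text \<open>Monomials in the three generators span the subalgebra, and those containing
  \<open>Var 3\<close> are killed automatically.\<close>

lemma slice_sum_reflection_subalg_eq_0:
  fixes f :: "'k::comm_ring_1 mpoly"
  assumes "\<And>r t. slice_sum i j N s (orbit_product k l a c ^ r * Var l ^ t) = 0"
    and "f \<in> reflection_subalg k l a c"
  shows "slice_sum i j N s f = 0"
proof -
  let ?g = "orbit_product k l a c" and ?V = "{f. slice_sum i j N s f = 0}"
  let ?M = "{?g ^ r * Var l ^ t * Var 3 ^ n | r t n. True}"
  have "f \<in> ?V"
    using assms(2) unfolding reflection_subalg_def
  proof (rule subalg_subset_subspace[where M = ?M])
    show "1 \<in> ?M"
      using power_0 mult_1 by (metis (mono_tags, lifting) mem_Collect_eq)
  next
    fix g m
    assume "g \<in> {?g, Var l, Var 3}" "m \<in> ?M"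
    then obtain r t n where "g = ?g \<or> g = Var l \<or> g = Var 3" "m = ?g ^ r * Var l ^ t * Var 3 ^ n"
      by auto
    then have "m * g = ?g ^ Suc r * Var l ^ t * Var 3 ^ n \<or> m * g = ?g ^ r * Var l ^ Suc t * Var 3 ^ n \<or>
        m * g = ?g ^ r * Var l ^ t * Var 3 ^ Suc n"
      by (auto simp: mult_ac)
    then show "m * g \<in> ?M"
      by blast
  next
    have "slice_sum i j N s (?g ^ r * Var l ^ t * Var 3 ^ n) = 0" for r t n
      using assms(1) slice_sum_Var3_mult[of i j N s "?g ^ r * Var l ^ t * Var 3 ^ (n - 1)"]
      by (cases n) (simp_all add: mult_ac)
    then show "?M \<subseteq> ?V"
      by auto
  qed (simp_all add: weighted_sum_add weighted_sum_Const_mult)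
  then show ?thesis by simp
qed

lemma polyring_neq_ssumI:
  assumes "\<And>f. f \<in> U \<Longrightarrow> weighted_sum w f = 0" "\<And>f. f \<in> V \<Longrightarrow> weighted_sum w f = 0"
    and "f \<in> polyring" "weighted_sum w f \<noteq> 0"
  shows "polyring \<noteq> ssum U V"
proof
  assume "polyring = ssum U V"
  with assms(3) obtain u v where "f = u + v" "u \<in> U" "v \<in> V"
    unfolding ssum_def by blast
  with assms show False by (simp add: weighted_sum_add)
qed

lemma monomial_in_polyring:
  assumes "idx3 = {i, j, 3}"
  shows "Var i ^ k * Var j ^ l \<in> polyring"
  unfolding polyring_eq[OF assms] by (intro subalg.mult subalg_power subalg.gen) auto

text \<open>Modulo \<open>\<omega>\<^sub>3\<close> and \<open>q\<close>, the first subalgebra is spanned by powers of \<open>\<omega>\<^sub>j\<close> and the second by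
  powers of \<open>\<omega>\<^sub>i\<close>; the Lucas-weighted functional kills \<open>\<omega>\<^sub>3\<close> and \<open>q\<close>, and it kills \<open>\<omega>\<^sub>i\<^sup>N\<close> once
  \<open>U\<^sub>N = 0\<close>.\<close>
lemma polyring_neq_ssum_nondegenerate:
  fixes a b c d :: "'k::{field,finite}"
  assumes idx: "idx3 = {i, j, 3}" and ij: "distinct [i, j, 3]" and "a \<noteq> 0" "b \<noteq> 0"
  shows "polyring \<noteq> ssum (reflection_subalg i j a c) (reflection_subalg j i b d)"
proof -
  define Q where "Q = a / b"
  have Q: "Q \<noteq> 0" "Q * b = a" using assms by (simp_all add: Q_def)
  obtain N where N: "N > 0" "lucas a Q N = 0"
    using lucas_periodic[OF Q(1)] by blast
  let ?L = "slice_sum i j N (lucas a Q)"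
  have rec: "?L (Var i * (Var i * f)) - a * ?L (Var i * (Var j * f))
      + Q * ?L (Var j * (Var j * f)) = 0" for f
    using slice_sum_recurrence[OF ij, of 1 "lucas a Q" "- a" Q N f] by simp
  \<comment> \<open>Under \<open>?L\<close> the two orbit products act as
    \<open>Q * (Var j)\<^sup>2\<close> and \<open>(Var i)\<^sup>2 / Q\<close>, so their powers
    reduce to pure powers of one variable.\<close>
  have u: "?L (orbit_product i j a c * f) = Q * ?L (Var j * (Var j * f))" for f
    unfolding slice_sum_orbit_product_mult using rec[of f] by (simp add: algebra_simps)
  have v: "?L (orbit_product j i b d * f) = ?L (Var i * (Var i * f)) / Q" for f
  proof -
    have "Q * ?L (orbit_product j i b d * f) =
        Q * b * ?L (Var i * (Var j * f)) - Q * ?L (Var j * (Var j * f))"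
      unfolding slice_sum_orbit_product_mult mult.left_commute[of "Var j" "Var i"]
      by (simp only: right_diff_distrib mult.assoc)
    also have "\<dots> = ?L (Var i * (Var i * f))"
      unfolding Q(2) using rec[of f] by (simp add: algebra_simps)
    finally show ?thesis
      using Q(1) by (simp add: field_simps)
  qed
  have kills_left: "?L (orbit_product i j a c ^ r * Var j ^ t) = 0" for r t
  proof (induction r arbitrary: t)
    case 0
    then show ?case using slice_sum_monomial[OF ij, of N "lucas a Q" 0 t] by simp
  next
    case (Suc r)
    show ?case
      using Suc[of "Suc (Suc t)"] u[of "orbit_product i j a c ^ r * Var j ^ t"] by (simp add: mult_ac)
  qed
  have kills_right: "?L (orbit_product j i b d ^ r * Var i ^ t) = 0" for r t
  proof (induction r arbitrary: t)
    case 0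
    then show ?case using slice_sum_monomial[OF ij, of N "lucas a Q" t 0] N by simp
  next
    case (Suc r)
    show ?case
      using Suc[of "Suc (Suc t)"] v[of "orbit_product j i b d ^ r * Var i ^ t"] by (simp add: mult_ac)
  qed
  have nonzero: "?L (Var i ^ 1 * Var j ^ (N - 1)) \<noteq> 0"
    unfolding slice_sum_monomial[OF ij] using N(1) by simp
  show ?thesis
    by (rule polyring_neq_ssumI, erule slice_sum_reflection_subalg_eq_0[OF kills_left],
        erule slice_sum_reflection_subalg_eq_0[OF kills_right], rule monomial_in_polyring[OF idx],
        rule nonzero)
qed

text \<open>Write \<open>v\<close> for the orbit product of \<open>\<omega>\<^sub>j\<close>. Modulo \<open>\<omega>\<^sub>3\<close> and \<open>\<omega>\<^sub>i\<^sup>2\<close> one has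
  \<open>v\<^sup>r = \<plusminus> (\<omega>\<^sub>j\<^sup>2\<^sup>r - r b \<omega>\<^sub>i \<omega>\<^sub>j\<^sup>2\<^sup>r\<^sup>-\<^sup>1)\<close>, whose second term vanishes for \<open>r\<close> the characteristic. In \<open>vf\<close>
  below the truncated exponent \<open>2 * r - 1\<close> at \<open>r = 0\<close> is harmless because of the factor \<open>r\<close>.\<close>
lemma polyring_neq_ssum_degenerate:
  fixes b c d :: "'k::{field,finite}"
  assumes idx: "idx3 = {i, j, 3}" and ij: "distinct [i, j, 3]"
  shows "polyring \<noteq> ssum (reflection_subalg i j 0 c) (reflection_subalg j i b d)"
proof -
  define p where "p = CHAR('k)"
  have p: "p > 0" "of_nat p = (0 :: 'k)"
    unfolding p_def by (simp_all add: finite_imp_CHAR_pos)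
  \<comment> \<open>In degree \<open>2 * p\<close> this reads off the coefficient of
    \<open>Var i * Var j ^ (2 * p - 1)\<close>, and it kills all multiples of
    \<open>(Var i)\<^sup>2\<close>.\<close>
  define s :: "nat \<Rightarrow> 'k" where "s = (\<lambda>k. if k = 1 then 1 else 0)"
  have s [simp]: "s 0 = 0" "s (Suc 0) = 1" "s (Suc (Suc k)) = 0" for k
    by (simp_all add: s_def)
  let ?L = "slice_sum i j (2 * p) s" and ?v = "orbit_product j i b d"
  have XX: "?L (Var i * (Var i * f)) = 0" for f
    using slice_sum_recurrence[OF ij, of 1 s 0 0 "2 * p" f] by simp
  \<comment> \<open>Modulo \<open>Var 3\<close> the orbit product is just
    \<open>- (Var i)\<^sup>2\<close> here.\<close>
  have u: "?L (orbit_product i j 0 c * f) = 0" for f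
    by (simp add: slice_sum_orbit_product_mult XX)
  have v: "?L (?v * f) = b * ?L (Var i * (Var j * f)) - ?L (Var j * (Var j * f))" for f
    by (simp add: slice_sum_orbit_product_mult mult.left_commute[of "Var j" "Var i"])
  have mono: "?L (Var i ^ k * Var j ^ l) = (if k + l = 2 * p then s k else 0)" for k l
    by (rule slice_sum_monomial[OF ij])
  have Xv: "?L (Var i * (?v ^ r * f)) = (- 1) ^ r * ?L (Var i * (Var j ^ (2 * r) * f))" for r f
  proof (induction r arbitrary: f)
    case (Suc r)
    have "?L (Var i * (?v ^ Suc r * f)) = (- 1) ^ r * ?L (?v * (Var i * (Var j ^ (2 * r) * f)))"
      using Suc[of "?v * f"] by (simp add: mult_ac)
    also have "\<dots> = (- 1) ^ Suc r * ?L (Var i * (Var j ^ (2 * Suc r) * f))"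
      unfolding v using XX[of "Var j * (Var j ^ (2 * r) * f)"] by (simp add: mult_ac)
    finally show ?case .
  qed simp
  have vf: "?L (?v ^ r * f) = (- 1) ^ r *
      (?L (Var j ^ (2 * r) * f) - of_nat r * b * ?L (Var i * (Var j ^ (2 * r - 1) * f)))" for r f
  proof (induction r arbitrary: f)
    case (Suc r)
    have 1: "?L (Var j ^ (2 * r) * (?v * f)) =
        b * ?L (Var i * (Var j ^ (2 * r + 1) * f)) - ?L (Var j ^ (2 * Suc r) * f)"
      using v[of "Var j ^ (2 * r) * f"] by (simp add: mult_ac)
    have 2: "of_nat r * ?L (Var i * (Var j ^ (2 * r - 1) * (?v * f))) =
        - (of_nat r * ?L (Var i * (Var j ^ (2 * r + 1) * f)))"
    proof (cases r)
      case (Suc r')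
      then show ?thesis
        using v[of "Var i * (Var j ^ (2 * r - 1) * f)"] XX[of "Var j * (Var j ^ (2 * r - 1) * f)"]
        by (simp add: mult_ac)
    qed simp
    have "?L (?v ^ Suc r * f) = (- 1) ^ r * (?L (Var j ^ (2 * r) * (?v * f))
        - b * (of_nat r * ?L (Var i * (Var j ^ (2 * r - 1) * (?v * f)))))"
      using Suc[of "?v * f"] by (simp add: mult_ac)
    also have "\<dots> = (- 1) ^ Suc r * (?L (Var j ^ (2 * Suc r) * f)
        - of_nat (Suc r) * b * ?L (Var i * (Var j ^ (2 * Suc r - 1) * f)))"
      unfolding 1 2 by (simp add: algebra_simps)
    finally show ?case .
  qed simp
  have kills_left: "?L (orbit_product i j 0 c ^ r * Var j ^ t) = 0" for r t
    using mono[of 0 t] by (cases r) (simp_all add: u mult.assoc)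
  have kills_right: "?L (?v ^ r * Var i ^ t) = 0" for r t
  proof -
    consider "t = 0" | "t = 1" | n where "t = Suc (Suc n)"
      by (metis One_nat_def not0_implies_Suc)
    then show ?thesis
    proof cases
      case 1
      \<comment> \<open>The degree equals \<open>2 * p\<close> only for \<open>r = p\<close>, and
        then \<open>of_nat r\<close> vanishes in the field.\<close>
      have "of_nat r * ?L (Var i * Var j ^ (2 * r - 1)) = 0"
        using mono[of 1 "2 * r - 1"] p by (cases "r = p") auto
      then have 2: "of_nat r * b * ?L (Var i * Var j ^ (2 * r - 1)) = 0"
        by auto
      have 3: "?L (Var j ^ (2 * r)) = 0"
        using mono[of 0 "2 * r"] by simp
      have "?L (?v ^ r) = (- 1) ^ r * (0 - 0)"
        using vf[of r 1] unfolding mult_1_right 2 3 .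
      then show ?thesis
        using 1 by simp
    next
      case 2
      \<comment> \<open>Parity: the monomial has odd degree, while the functional lives in degree
        \<open>2 * p\<close>.\<close>
      have "?L (Var i * Var j ^ (2 * r)) = 0"
      proof -
        have "1 + 2 * r \<noteq> 2 * p" by presburger
        then show ?thesis using mono[of 1 "2 * r"] by simp
      qed
      then show ?thesis
        using 2 Xv[of r 1] by (simp add: mult_ac)
    next
      case 3
      then show ?thesis
        using XX[of "?v ^ r * Var i ^ n"] by (simp add: mult_ac)
    qed
  qed
  have nonzero: "?L (Var i ^ 1 * Var j ^ (2 * p - 1)) \<noteq> 0"
    unfolding mono using p(1) by simp
  show ?thesis
    by (rule polyring_neq_ssumI, erule slice_sum_reflection_subalg_eq_0[OF kills_left],
        erule slice_sum_reflection_subalg_eq_0[OF kills_right], rule monomial_in_polyring[OF idx],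
        rule nonzero)
qed

section \<open>Specialization to the entries of the Cartan matrix\<close>

theorem theorem7p1:
  fixes A :: "nat \<Rightarrow> nat \<Rightarrow> int"
  assumes "cartan3 A" and "infinite_type3 A"
    and "prime CARD('p)"
    and "A 1 2 * A 2 1 \<ge> 4"
  shows "(polyring :: rat mpoly set) =
           ssum (invariants A 1 :: rat mpoly set) (invariants A 2)
       \<and> ssum (invariants A 1 :: rat mpoly set) (invariants A 2) =
           ssum (subalg {Var 1 * (Var 1 - alpha A 1), Var 2, Var 3} :: rat mpoly set)
                (subalg {Var 1, Var 2 * (Var 2 - alpha A 2), Var 3})
       \<and> (polyring :: ('p::{field,finite}) mpoly set) \<noteq>
           ssum (subalg {Var 1 * (Var 1 - alpha A 1), Var 2, Var 3} :: 'p mpoly set)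
                (subalg {Var 1, Var 2 * (Var 2 - alpha A 2), Var 3})"
proof -
  have idx: "idx3 = {1, 2, 3}" "idx3 = {2, 1, 3}" and dist: "distinct [1, 2, 3 :: nat]" "distinct [2, 1, 3 :: nat]"
    by (auto simp: idx3_def)
  note subset_inv = reflection_subalg_subset_invariants[OF assms(1) idx(1) dist(1)]
    reflection_subalg_subset_invariants[OF assms(1) idx(2) dist(2)]
  have subalgs: "subalg {Var 1 * (Var 1 - alpha A 1), Var 2, Var 3} =
      (reflection_subalg 1 2 (of_int (- A 2 1)) (of_int (- A 3 1)) :: 'k::comm_ring_1 mpoly set)"
    "subalg {Var 1, Var 2 * (Var 2 - alpha A 2), Var 3} =
      (reflection_subalg 2 1 (of_int (- A 1 2)) (of_int (- A 3 2)) :: 'k mpoly set)"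
    unfolding reflection_subalg_def orbit_product_eq[OF assms(1) idx(1) dist(1)]
      orbit_product_eq[OF assms(1) idx(2) dist(2)]
    by (simp_all add: insert_commute)
  have "A 2 1 \<le> 0" "A 1 2 \<le> 0"
    using assms(1) by (auto simp: cartan3_def idx3_def)
  moreover have "A 2 1 \<noteq> 0" "A 1 2 \<noteq> 0"
    using assms(4) by auto
  moreover have "(4 :: rat) \<le> of_int (A 1 2 * A 2 1)"
    using assms(4) by linarith
  ultimately have "ssum (reflection_subalg 1 2 (of_int (- A 2 1)) (of_int (- A 3 1)))
      (reflection_subalg 2 1 (of_int (- A 1 2)) (of_int (- A 3 2))) = (polyring :: rat mpoly set)"
    by (intro ssum_reflection_subalgs_eq_polyring[OF idx(1)]) (auto simp: mult.commute)
  moreover have "ssum (invariants A 1) (invariants A 2) \<subseteq> (polyring :: rat mpoly set)"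
    by (auto simp: ssum_def invariants_def polyring_def intro: subalg.add)
  \<comment> \<open>The sum of the invariants is squeezed between the sum of the subalgebras and
    \<open>polyring\<close>, which coincide over the rationals.\<close>
  moreover note ssum_mono[OF subset_inv]
  moreover have "polyring \<noteq> ssum (reflection_subalg 1 2 (of_int (- A 2 1)) (of_int (- A 3 1)))
      (reflection_subalg 2 1 (of_int (- A 1 2)) (of_int (- A 3 2)) :: 'p mpoly set)" (is "_ \<noteq> ssum ?U ?V")
  proof -
    consider "(of_int (- A 2 1) :: 'p) = 0" | "(of_int (- A 1 2) :: 'p) = 0"
      | "(of_int (- A 2 1) :: 'p) \<noteq> 0" "(of_int (- A 1 2) :: 'p) \<noteq> 0"
      by blast
    then show ?thesis
    proof cases
      case 1
      show ?thesis unfolding 1 by (rule polyring_neq_ssum_degenerate[OF idx(1) dist(1)])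
    next
      case 2
      \<comment> \<open>The vanishing parameter has to come first, so the two reflections trade
        roles.\<close>
      show ?thesis unfolding 2 ssum_commute[of ?U]
        by (rule polyring_neq_ssum_degenerate[OF idx(2) dist(2)])
    next
      case 3
      then show ?thesis by (rule polyring_neq_ssum_nondegenerate[OF idx(1) dist(1)])
    qed
  qed
  ultimately show ?thesis
    unfolding subalgs by blast
qed

end
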